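(* Let $f,g:\mathbb{R}^n\to\mathbb{R}\cup\{\infty\}$ be proper, lower semicontinuous, convex functions, and let $h:=f\square g$, that is, $h(x)=\inf_{y\in\mathbb{R}^n}\{f(x-y)+g(y)\}$. Assume that $h$ is proper and lower semicontinuous with $\mathrm{dom}\,h$ unbounded. Then: (i) $\partial h(\infty)\subset\mathrm{cl}(\mathrm{dom}\,f^*\cap\mathrm{dom}\,g^* )$; (ii) if $f$ and $g$ are sublinear and finite-valued, then $\partial h(\infty)=\partial f(\infty)\cap\partial g(\infty)$; (iii) if $f$ and $g$ are polyhedral, then $\partial h(\infty)\subset\mathrm{dom}\,f^*\cap\mathrm{dom}\,g^*$, with equality when $\mathrm{dom}\,f+\mathrm{dom}\,g=\mathbb{R}^n$.
   Context: Proper functions take values in $\mathbb{R}\cup\{\infty\}$ and have nonempty domain. For $\varphi:\mathbb{R}^n\to\mathbb{R}\cup\{\infty\}$: $\mathrm{dom}\,\varphi=\{x\mid\varphi(x)<\infty\}$; $\mathrm{epi}\,\varphi=\{(x,r)\in\mathbb{R}^n\times\mathbb{R}\mid r\ge\varphi(x)\}$; $\varphi^*(u)=\sup_x\{\langle u,x\rangle-\varphi(x)\}$ is the Fenchel conjugate. A convex function is polyhedral if its epigraph is a polyhedral convex set (finite intersection of closed half-spaces). Sublinear means subadditive and positively homogeneous. $\mathrm{cl}$ is topological closure. For $\varphi$ proper, lower semicontinuous, convex with $\mathrm{dom}\,\varphi$ unbounded, and $I=\{1,\dots,n\}$ selecting the $x$-coordinates in $\mathbb{R}^n\times\mathbb{R}$: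 $T(\infty_I;\mathrm{epi}\,\varphi)$ is the set of $(w,\rho)$ such that for all sequences $(x_k,r_k)\in\mathrm{epi}\,\varphi$ with $\|x_k\|\to\infty$ and all $t_k>0$ with $t_k\to0$ there exist $(w_k,\rho_k)\to(w,\rho)$ with $(x_k,r_k)+t_k(w_k,\rho_k)\in\mathrm{epi}\,\varphi$ for all $k$. $N(\infty_I;\mathrm{epi}\,\varphi)=\{(u,c)\mid\langle u,w\rangle+c\rho\le0\ \forall(w,\rho)\in T(\infty_I;\mathrm{epi}\,\varphi)\}$, and $\partial\varphi(\infty)=\{u\mid(u,-1)\in N(\infty_I;\mathrm{epi}\,\varphi)\}$. *)

theory Defs
  imports "HOL-Analysis.Analysis"
begin

(* Functions into R \<union> {\<infinity>} are ereal-valued; the value -\<infinity> is excluded by proper_fun. *)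

definition dom_fun :: "('a \<Rightarrow> ereal) \<Rightarrow> 'a set" where
  "dom_fun \<phi> = {x. \<phi> x < \<infinity>}"

definition proper_fun :: "('a \<Rightarrow> ereal) \<Rightarrow> bool" where
  "proper_fun \<phi> \<longleftrightarrow> (\<forall>x. \<phi> x \<noteq> -\<infinity>) \<and> dom_fun \<phi> \<noteq> {}"

definition finite_valued :: "('a \<Rightarrow> ereal) \<Rightarrow> bool" where
  "finite_valued \<phi> \<longleftrightarrow> (\<forall>x. \<bar>\<phi> x\<bar> \<noteq> \<infinity>)"

definition epi :: "('a \<Rightarrow> ereal) \<Rightarrow> ('a \<times> real) set" where
  "epi \<phi> = {(x, r). \<phi> x \<le> ereal r}"

definition lsc :: "('a::topological_space \<Rightarrow> ereal) \<Rightarrow> bool" where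
  "lsc \<phi> \<longleftrightarrow> (\<forall>x. \<phi> x \<le> Liminf (at x) \<phi>)"

definition convex_fun :: "('a::real_vector \<Rightarrow> ereal) \<Rightarrow> bool" where
  "convex_fun \<phi> \<longleftrightarrow> convex (epi \<phi>)"

definition polyhedral_fun :: "('a::euclidean_space \<Rightarrow> ereal) \<Rightarrow> bool" where
  "polyhedral_fun \<phi> \<longleftrightarrow> polyhedron (epi \<phi>)"

(* Homogeneity is only required for l > 0, so \<phi> 0 = 0 is not imposed. *)
definition sublinear_fun :: "('a::real_vector \<Rightarrow> ereal) \<Rightarrow> bool" where
  "sublinear_fun \<phi> \<longleftrightarrow>
     (\<forall>x y. \<phi> (x + y) \<le> \<phi> x + \<phi> y) \<and>
     (\<forall>l>0. \<forall>x. \<phi> (l *\<^sub>R x) = ereal l * \<phi> x)"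

definition fenchel_conjugate :: "('a::real_inner \<Rightarrow> ereal) \<Rightarrow> 'a \<Rightarrow> ereal" where
  "fenchel_conjugate \<phi> u = (SUP x. ereal (u \<bullet> x) - \<phi> x)"

definition inf_convolution ::
  "('a::real_vector \<Rightarrow> ereal) \<Rightarrow> ('a \<Rightarrow> ereal) \<Rightarrow> 'a \<Rightarrow> ereal" where
  "inf_convolution f g x = (INF y. f (x - y) + g y)"

(* T(\<infinity>_I; \<Omega>) for \<Omega> \<subseteq> R^n \<times> R, where I selects the R^n-coordinates: only the x-part of
   the base points (x_k, r_k) is required to go to infinity; r_k is unrestricted. *)
definition tangent_at_infinity ::
  "('a::euclidean_space \<times> real) set \<Rightarrow> ('a \<times> real) set" where
  "tangent_at_infinity \<Omega> =
     {v. \<forall>(z :: nat \<Rightarrow> 'a \<times> real) (t :: nat \<Rightarrow> real).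
           (\<forall>k. z k \<in> \<Omega>) \<longrightarrow> filterlim (\<lambda>k. norm (fst (z k))) at_top sequentially \<longrightarrow>
           (\<forall>k. t k > 0) \<longrightarrow> t \<longlonglongrightarrow> 0 \<longrightarrow>
           (\<exists>s :: nat \<Rightarrow> 'a \<times> real. s \<longlonglongrightarrow> v \<and> (\<forall>k. z k + t k *\<^sub>R s k \<in> \<Omega>))}"

definition normal_at_infinity ::
  "('a::euclidean_space \<times> real) set \<Rightarrow> ('a \<times> real) set" where
  "normal_at_infinity \<Omega> =
     {(u, c). \<forall>(w, \<rho>) \<in> tangent_at_infinity \<Omega>. u \<bullet> w + c * \<rho> \<le> 0}"

definition subdiff_at_infinity :: "('a::euclidean_space \<Rightarrow> ereal) \<Rightarrow> 'a set" where
  "subdiff_at_infinity \<phi> = {u. (u, -1) \<in> normal_at_infinity (epi \<phi>)}"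

end

theory Submission
  imports Defs
begin

text \<open>Every recession direction of \<open>epi \<phi>\<close> is tangent at infinity, so \<open>\<partial>\<phi>(\<infinity>)\<close> consists of
  vectors \<open>u\<close> with \<open>(u, -1)\<close> in the polar of the recession cone. That polar is the closure of the
  barrier cone, and the barrier cone itself for a polyhedron, while \<open>(u, -1)\<close> is in the barrier cone
  iff \<open>\<phi>\<^sup>*(u) < \<infinity>\<close>. Since \<open>dom h\<^sup>* = dom f\<^sup>* \<inter> dom g\<^sup>*\<close> and \<open>epi h\<close> recedes wherever \<open>epi f\<close> or
  \<open>epi g\<close> does, the inclusions follow. Conversely \<open>dom \<phi>\<^sup>* \<subseteq> \<partial>\<phi>(\<infinity>)\<close> for every finite, globally
  Lipschitz convex \<open>\<phi>\<close>, which covers the sublinear case and the polyhedral case with full domain.\<close>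

section \<open>Recession and barrier cones\<close>

text \<open>Quantifying over every base point makes this a convex cone for arbitrary
  \<open>S\<close>; for a nonempty closed convex set it is the classical recession cone.\<close>

definition recession_cone :: "'a::real_vector set \<Rightarrow> 'a set" where
  "recession_cone S = {d. \<forall>z\<in>S. \<forall>t\<ge>0. z + t *\<^sub>R d \<in> S}"

text \<open>The domain of the support function of \<open>S\<close>. It need not be closed, which is
  where the closure in (i) comes from.\<close>

definition barrier_cone :: "'a::real_inner set \<Rightarrow> 'a set" where
  "barrier_cone S = {b. \<exists>M. \<forall>z\<in>S. b \<bullet> z \<le> M}"

lemma convex_cone_recession_cone: "convex_cone (recession_cone S)"
  unfolding convex_cone_iff
proof (intro conjI ballI allI impI)
  show "0 \<in> recession_cone S" by (simp add: recession_cone_def)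
next
  fix x y assume xy: "x \<in> recession_cone S" "y \<in> recession_cone S"
  show "x + y \<in> recession_cone S"
    unfolding recession_cone_def
  proof (intro CollectI ballI allI impI)
    fix z t assume "z \<in> S" "0 \<le> (t::real)"
    with xy have "(z + t *\<^sub>R x) + t *\<^sub>R y \<in> S" by (simp add: recession_cone_def)
    then show "z + t *\<^sub>R (x + y) \<in> S" by (simp add: algebra_simps)
  qed
next
  fix x c assume "x \<in> recession_cone S" "0 \<le> (c::real)"
  then show "c *\<^sub>R x \<in> recession_cone S" by (simp add: recession_cone_def)
qed

lemma convex_cone_barrier_cone: "convex_cone (barrier_cone S)"
  unfolding convex_cone_iff
proof (intro conjI ballI allI impI)
  show "0 \<in> barrier_cone S" by (auto simp: barrier_cone_def)
next
  fix x y assume "x \<in> barrier_cone S" "y \<in> barrier_cone S"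
  then obtain M N where "\<forall>z\<in>S. x \<bullet> z \<le> M" "\<forall>z\<in>S. y \<bullet> z \<le> N"
    by (auto simp: barrier_cone_def)
  then have "\<forall>z\<in>S. (x + y) \<bullet> z \<le> M + N" by (simp add: inner_add_left add_mono)
  then show "x + y \<in> barrier_cone S" by (auto simp: barrier_cone_def)
next
  fix x c assume "x \<in> barrier_cone S" and c: "0 \<le> (c::real)"
  then obtain M where "\<forall>z\<in>S. x \<bullet> z \<le> M"
    by (auto simp: barrier_cone_def)
  then have "\<forall>z\<in>S. (c *\<^sub>R x) \<bullet> z \<le> c * M" using c by (simp add: mult_left_mono)
  then show "c *\<^sub>R x \<in> barrier_cone S" by (auto simp: barrier_cone_def)
qed

text \<open>A positive value could be scaled beyond any bound \<open>M\<close>.\<close>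

lemma convex_cone_bounded_above_imp_nonpos:
  fixes C :: "'a::real_inner set"
  assumes C: "convex_cone C" and b: "\<And>x. x \<in> C \<Longrightarrow> a \<bullet> x \<le> M" and "x \<in> C"
  shows "a \<bullet> x \<le> 0"
proof (rule ccontr)
  assume "\<not> a \<bullet> x \<le> 0"
  then have pos: "a \<bullet> x > 0" by simp
  obtain n :: nat where "M < n * (a \<bullet> x)" using pos reals_Archimedean3 by blast
  moreover have "a \<bullet> (real n *\<^sub>R x) \<le> M"
    by (rule b[OF convex_cone_scaleR[OF C _ \<open>x \<in> C\<close>]]) simp
  ultimately show False by simp
qed

lemma separate_convex_cone:
  fixes C :: "'a::euclidean_space set"
  assumes C: "convex_cone C" and z: "z \<notin> closure C"
  obtains a where "a \<bullet> z > 0" "\<And>x. x \<in> C \<Longrightarrow> a \<bullet> x \<le> 0"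
proof -
  have "convex (closure C)" using C by (simp add: convex_cone_def convex_closure)
  from separating_hyperplane_closed_point[OF this closed_closure z]
  obtain a b where ab: "a \<bullet> z < b" "\<forall>x\<in>closure C. a \<bullet> x > b" by blast
  have le: "(- a) \<bullet> x \<le> - b" if "x \<in> C" for x
    using ab(2) that closure_subset[of C] by (auto simp: less_imp_le)
  have "(- a) \<bullet> x \<le> 0" if "x \<in> C" for x
    by (rule convex_cone_bounded_above_imp_nonpos[OF C le that])
  \<comment> \<open>The point 0 lies in the closure, so the threshold is negative and
    \<open>a \<bullet> z\<close> with it; flipping the sign of \<open>a\<close> gives the
    claim.\<close>
  moreover have "b < 0" using ab(2) convex_cone_contains_0[OF C] closure_subset[of C] by force
  ultimately show thesis using that[of "- a"] ab(1) by simp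
qed

text \<open>Bipolar argument: a vector \<open>a\<close> separating \<open>b\<close> from the barrier
  cone is polar to that cone. Were \<open>a\<close> to lead out of \<open>S\<close>, a hyperplane
  cutting off the exit point would yield a barrier functional increasing along \<open>a\<close>. So
  \<open>a\<close> is a recession direction, contrary to the assumption on \<open>b\<close>.\<close>

lemma polar_recession_cone_subset_closure_barrier_cone:
  fixes S :: "'a::euclidean_space set"
  assumes S: "convex S" "closed S" and b: "\<And>d. d \<in> recession_cone S \<Longrightarrow> b \<bullet> d \<le> 0"
  shows "b \<in> closure (barrier_cone S)"
proof (rule ccontr)
  assume "b \<notin> closure (barrier_cone S)"
  then obtain a where ab: "a \<bullet> b > 0" and a: "\<And>x. x \<in> barrier_cone S \<Longrightarrow> a \<bullet> x \<le> 0"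
    using separate_convex_cone[OF convex_cone_barrier_cone] by blast
  have "a \<in> recession_cone S"
    unfolding recession_cone_def
  proof (intro CollectI ballI allI impI, rule ccontr)
    fix z and t :: real assume z: "z \<in> S" "0 \<le> t" "z + t *\<^sub>R a \<notin> S"
    from separating_hyperplane_closed_point[OF S z(3)]
    obtain c \<gamma> where c: "c \<bullet> (z + t *\<^sub>R a) < \<gamma>" "\<forall>x\<in>S. c \<bullet> x > \<gamma>" by blast
    then have "- c \<in> barrier_cone S"
      unfolding barrier_cone_def by (auto intro!: exI[of _ "- \<gamma>"] simp: less_imp_le)
    from a[OF this] have "a \<bullet> c \<ge> 0" by simp
    then have "t * (c \<bullet> a) \<ge> 0" using z(2) by (simp add: inner_commute)
    moreover have "c \<bullet> z > \<gamma>" using c(2) z(1) by blast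
    ultimately show False using c(1) by (simp add: inner_add_right)
  qed
  from b[OF this] ab show False by (simp add: inner_commute)
qed

text \<open>Farkas' lemma: the cone generated by the finitely many facet normals is closed.\<close>

lemma polar_recession_cone_subset_barrier_cone_polyhedron:
  fixes S :: "'a::euclidean_space set"
  assumes S: "polyhedron S" and b: "\<And>d. d \<in> recession_cone S \<Longrightarrow> b \<bullet> d \<le> 0"
  shows "b \<in> barrier_cone S"
proof -
  obtain F where F: "finite F" "S = \<Inter>F" "\<forall>h\<in>F. \<exists>a b. a \<noteq> 0 \<and> h = {x. a \<bullet> x \<le> b}"
    using S unfolding polyhedron_def by blast
  then obtain A B where AB: "\<And>h. h \<in> F \<Longrightarrow> h = {x. A h \<bullet> x \<le> B h}" by metis
  let ?C = "convex_cone hull (A ` F)"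
  have memS: "z \<in> S \<longleftrightarrow> (\<forall>h\<in>F. A h \<bullet> z \<le> B h)" for z
    using AB F(2) by blast
  have sub: "?C \<subseteq> barrier_cone S"
  proof (rule hull_minimal[where S = convex_cone])
    show "A ` F \<subseteq> barrier_cone S" using memS by (auto simp: barrier_cone_def)
  qed (rule convex_cone_barrier_cone)
  have "b \<in> closure ?C"
  proof (rule ccontr)
    assume "b \<notin> closure ?C"
    then obtain d where d: "d \<bullet> b > 0" "\<And>x. x \<in> ?C \<Longrightarrow> d \<bullet> x \<le> 0"
      using separate_convex_cone[OF convex_cone_convex_cone_hull] by blast
    \<comment> \<open>The separating vector increases no facet functional, so moving along it
      preserves every defining inequality.\<close>
    have "A h \<bullet> d \<le> 0" if "h \<in> F" for h
      using d(2)[of "A h"] that by (simp add: hull_inc inner_commute)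
    then have "d \<in> recession_cone S"
      unfolding recession_cone_def
      by (auto simp: memS inner_add_right intro!: add_decreasing2 mult_nonneg_nonpos)
    from b[OF this] d(1) show False by (simp add: inner_commute)
  qed
  then show ?thesis
    using sub closure_closed[OF closed_convex_cone_hull[of "A ` F"]] F(1) by auto
qed

section \<open>Tangents at infinity and the domain of the conjugate\<close>

text \<open>The constant sequence \<open>d\<close> serves for all base points and all step
  sizes.\<close>

lemma recession_cone_subset_tangent_at_infinity:
  "recession_cone S \<subseteq> tangent_at_infinity S"
proof
  fix d assume d: "d \<in> recession_cone S"
  show "d \<in> tangent_at_infinity S"
    unfolding tangent_at_infinity_def
  proof (intro CollectI allI impI exI[of _ "\<lambda>_. d"] conjI)
    fix z :: "nat \<Rightarrow> 'a \<times> real" and t :: "nat \<Rightarrow> real" and k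
    assume "\<forall>k. z k \<in> S" "\<forall>k. 0 < t k"
    then show "z k + t k *\<^sub>R d \<in> S"
      using d by (simp add: recession_cone_def less_imp_le)
  qed simp
qed

lemma subdiff_at_infinityD:
  assumes "u \<in> subdiff_at_infinity \<phi>" "d \<in> recession_cone (epi \<phi>)"
  shows "(u, -1) \<bullet> d \<le> 0"
  using assms recession_cone_subset_tangent_at_infinity[of "epi \<phi>"]
  by (force simp: subdiff_at_infinity_def normal_at_infinity_def inner_prod_def)

lemma ereal_less_PInfty_bounded:
  fixes x :: ereal
  assumes "x < \<infinity>"
  shows "\<exists>M::real. x \<le> ereal M"
  using assms by (cases x) auto

text \<open>The conjugate at \<open>u\<close> is the support function of the epigraph at
  \<open>(u, -1)\<close>.\<close>

lemma dom_fenchel_conjugate_iff: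
  assumes \<phi>: "proper_fun \<phi>"
  shows "u \<in> dom_fun (fenchel_conjugate \<phi>) \<longleftrightarrow> (u, -1) \<in> barrier_cone (epi \<phi>)"
proof
  assume "u \<in> dom_fun (fenchel_conjugate \<phi>)"
  then have "fenchel_conjugate \<phi> u < \<infinity>" by (simp add: dom_fun_def)
  then obtain M where M: "fenchel_conjugate \<phi> u \<le> ereal M"
    using ereal_less_PInfty_bounded by blast
  have "u \<bullet> x - r \<le> M" if "\<phi> x \<le> ereal r" for x r
  proof -
    have "ereal (u \<bullet> x) - \<phi> x \<le> ereal M"
      using M unfolding fenchel_conjugate_def by (meson SUP_upper UNIV_I order_trans)
    moreover have "\<phi> x \<noteq> -\<infinity>" using \<phi> by (simp add: proper_fun_def)
    ultimately show ?thesis using that by (cases "\<phi> x") auto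
  qed
  then show "(u, -1) \<in> barrier_cone (epi \<phi>)"
    by (auto simp: barrier_cone_def epi_def intro!: exI[of _ M])
next
  assume "(u, -1) \<in> barrier_cone (epi \<phi>)"
  then obtain M where M: "\<And>x r. \<phi> x \<le> ereal r \<Longrightarrow> u \<bullet> x - r \<le> M"
    by (force simp: barrier_cone_def epi_def)
  have "ereal (u \<bullet> x) - \<phi> x \<le> ereal M" for x
  proof -
    \<comment> \<open>Where \<open>\<phi> x = \<infinity>\<close> the difference is
      \<open>-\<infinity>\<close>; elsewhere \<open>M\<close> is applied to the graph point over
      \<open>x\<close>.\<close>
    have "\<phi> x \<noteq> -\<infinity>" using \<phi> by (simp add: proper_fun_def)
    then show ?thesis using M[of x "real_of_ereal (\<phi> x)"] by (cases "\<phi> x") auto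
  qed
  then have "fenchel_conjugate \<phi> u \<le> ereal M"
    unfolding fenchel_conjugate_def by (simp add: SUP_least)
  then show "u \<in> dom_fun (fenchel_conjugate \<phi>)" by (auto simp: dom_fun_def)
qed

text \<open>Taking the slice at height -1 commutes with closure here: approximating points
  eventually have negative last coordinate and can be rescaled to height -1 within the cone.\<close>

lemma closure_barrier_cone_normalized:
  fixes S :: "('a::euclidean_space \<times> real) set"
  assumes "(u, -1) \<in> closure (barrier_cone S)"
  shows "u \<in> closure {v. (v, -1) \<in> barrier_cone S}"
proof -
  obtain s where s: "\<And>n. s n \<in> barrier_cone S" "s \<longlonglongrightarrow> (u, -1)"
    using assms unfolding closure_sequential by blast
  have lim: "(\<lambda>n. fst (s n)) \<longlonglongrightarrow> u" "(\<lambda>n. snd (s n)) \<longlonglongrightarrow> -1"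
    using tendsto_fst[OF s(2)] tendsto_snd[OF s(2)] by simp_all
  have "(\<lambda>n. inverse (- snd (s n)) *\<^sub>R fst (s n)) \<longlonglongrightarrow> inverse (- (-1)) *\<^sub>R u"
    by (intro tendsto_intros lim) simp
  then have lim': "(\<lambda>n. inverse (- snd (s n)) *\<^sub>R fst (s n)) \<longlonglongrightarrow> u" by simp
  have "eventually (\<lambda>n. snd (s n) < 0) sequentially"
    using order_tendstoD(2)[OF lim(2), of 0] by simp
  then have "eventually (\<lambda>n. inverse (- snd (s n)) *\<^sub>R fst (s n)
      \<in> closure {v. (v, -1) \<in> barrier_cone S}) sequentially"
  proof eventually_elim
    case (elim n)
    have "inverse (- snd (s n)) *\<^sub>R s n \<in> barrier_cone S"
      by (rule convex_cone_scaleR[OF convex_cone_barrier_cone _ s(1)]) (use elim in simp)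
    moreover have "inverse (- snd (s n)) *\<^sub>R s n = (inverse (- snd (s n)) *\<^sub>R fst (s n), -1)"
      using elim by (simp add: prod_eq_iff)
    ultimately show ?case using closure_subset by force
  qed
  from Lim_in_closed_set[OF closed_closure this _ lim'] show ?thesis by simp
qed

section \<open>Epigraphs\<close>

lemma closed_epi:
  fixes \<phi> :: "'a::metric_space \<Rightarrow> ereal"
  assumes "lsc \<phi>"
  shows "closed (epi \<phi>)"
  unfolding closed_sequential_limits
proof (intro allI impI)
  fix z l assume z: "(\<forall>n. z n \<in> epi \<phi>) \<and> z \<longlonglongrightarrow> l"
  obtain x r where l: "l = (x, r)" by (cases l)
  have lim: "(\<lambda>n. fst (z n)) \<longlonglongrightarrow> x" "(\<lambda>n. snd (z n)) \<longlonglongrightarrow> r"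
    using tendsto_fst tendsto_snd z l by fastforce+
  have ze: "\<phi> (fst (z n)) \<le> ereal (snd (z n))" for n
  proof -
    have "z n \<in> epi \<phi>" using z by blast
    then show ?thesis by (cases "z n") (simp add: epi_def)
  qed
  have "\<phi> x \<le> ereal r"
  proof (rule dense_le)
    fix c assume c: "c < \<phi> x"
    then have "c < Liminf (at x) \<phi>" using assms unfolding lsc_def by (meson less_le_trans)
    then have "eventually (\<lambda>y. c < \<phi> y) (at x)" by (rule less_LiminfD)
    \<comment> \<open>\<open>lsc\<close> speaks of punctured neighbourhoods;
      \<open>c < \<phi> x\<close> supplies the point itself, which the sequence may hit.\<close>
    then have "eventually (\<lambda>y. c < \<phi> y) (nhds x)"
      using c by (auto simp: eventually_at_filter elim: eventually_mono)
    then have "eventually (\<lambda>n. c < \<phi> (fst (z n))) sequentially"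
      using lim(1) unfolding filterlim_iff by blast
    then have "eventually (\<lambda>n. c \<le> ereal (snd (z n))) sequentially"
      by eventually_elim (use ze in \<open>meson less_imp_le order_trans\<close>)
    moreover have "(\<lambda>n. ereal (snd (z n))) \<longlonglongrightarrow> ereal r" using lim(2) by simp
    ultimately show "c \<le> ereal r"
      using tendsto_lowerbound trivial_limit_sequentially by blast
  qed
  then show "l \<in> epi \<phi>" by (simp add: l epi_def)
qed

text \<open>The infimum need not be attained, so the epigraph of the infimal convolution is the sum
  of the epigraphs only up to an arbitrarily small vertical shift.\<close>

lemma epi_inf_convolution:
  fixes f g :: "'a::real_vector \<Rightarrow> ereal"
  assumes f: "proper_fun f" and g: "proper_fun g"
  shows "epi (inf_convolution f g) =
    {z. \<forall>e>0. \<exists>p\<in>epi f. \<exists>q\<in>epi g. z + (0, e) = p + q}"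
proof (intro set_eqI iffI CollectI allI impI)
  fix z and e :: real assume z: "z \<in> epi (inf_convolution f g)" and e: "0 < e"
  obtain x r where xr: "z = (x, r)" by (cases z)
  have "inf_convolution f g x < ereal (r + e)"
    using z e xr by (auto simp: epi_def intro: le_less_trans)
  then obtain y where y: "f (x - y) + g y < ereal (r + e)"
    by (auto simp: inf_convolution_def INF_less_iff)
  obtain a where a: "f (x - y) = ereal a"
    using f y g by (cases "f (x - y)") (auto simp: proper_fun_def)
  obtain b where b: "g y = ereal b"
    using y g a by (cases "g y") (auto simp: proper_fun_def)
  \<comment> \<open>The \<open>f\<close>-summand absorbs all the remaining height, so the sum is
    exact.\<close>
  show "\<exists>p\<in>epi f. \<exists>q\<in>epi g. z + (0, e) = p + q"
    by (rule bexI[of _ "(x - y, r + e - b)"], rule bexI[of _ "(y, b)"])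
      (use a b y in \<open>auto simp: xr epi_def\<close>)
next
  fix z assume "z \<in> {z. \<forall>e>0. \<exists>p\<in>epi f. \<exists>q\<in>epi g. z + (0, e) = p + q}"
  then have z: "\<And>e. 0 < e \<Longrightarrow> \<exists>p\<in>epi f. \<exists>q\<in>epi g. z + (0, e) = p + q" by blast
  obtain x r where xr: "z = (x, r)" by (cases z)
  have "inf_convolution f g x \<le> ereal r + ereal e" if e: "0 < e" for e
  proof -
    obtain v a y b where *: "f v \<le> ereal a" "g y \<le> ereal b" "x = v + y" "r + e = a + b"
      using z[OF e] by (fastforce simp: epi_def xr)
    have "inf_convolution f g x \<le> f (x - y) + g y"
      unfolding inf_convolution_def by (rule INF_lower) simp
    also have "\<dots> \<le> ereal a + ereal b" using * by (intro add_mono) auto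
    finally show ?thesis using * by simp
  qed
  then have "inf_convolution f g x \<le> ereal r" by (rule ereal_le_epsilon2)
  then show "z \<in> epi (inf_convolution f g)" by (simp add: xr epi_def)
qed

lemma inf_convolution_commute: "inf_convolution f g = inf_convolution g f"
proof
  fix x
  have "inf_convolution p q x \<le> inf_convolution q p x" for p q :: "'a \<Rightarrow> ereal"
    unfolding inf_convolution_def
  proof (rule INF_greatest)
    fix y
    have "(INF y. p (x - y) + q y) \<le> p (x - (x - y)) + q (x - y)" by (rule INF_lower) simp
    then show "(INF y. p (x - y) + q y) \<le> q (x - y) + p y" by (simp add: add.commute)
  qed
  then show "inf_convolution f g x = inf_convolution g f x" by (meson antisym)
qed

lemma convex_epi_inf_convolution:
  fixes f g :: "'a::real_vector \<Rightarrow> ereal"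
  assumes f: "proper_fun f" "convex (epi f)" and g: "proper_fun g" "convex (epi g)"
  shows "convex (epi (inf_convolution f g))"
proof (rule convexI)
  fix z z' and u v :: real
  assume z: "z \<in> epi (inf_convolution f g)" "z' \<in> epi (inf_convolution f g)"
    and uv: "0 \<le> u" "0 \<le> v" "u + v = 1"
  show "u *\<^sub>R z + v *\<^sub>R z' \<in> epi (inf_convolution f g)"
    unfolding epi_inf_convolution[OF f(1) g(1)]
  proof (intro CollectI allI impI)
    fix e :: real assume "0 < e"
    then obtain p q p' q' where pq: "p \<in> epi f" "q \<in> epi g" "z + (0, e) = p + q"
      "p' \<in> epi f" "q' \<in> epi g" "z' + (0, e) = p' + q'"
      using z unfolding epi_inf_convolution[OF f(1) g(1)] by blast
    \<comment> \<open>The weights sum to 1, so a common shift \<open>e\<close> survives the convex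
      combination unchanged.\<close>
    have "u *\<^sub>R z + v *\<^sub>R z' + (0, e) = u *\<^sub>R (z + (0, e)) + v *\<^sub>R (z' + (0, e))"
      using uv(3) by (simp add: prod_eq_iff algebra_simps)
        (simp add: distrib_left[symmetric])
    also have "\<dots> = (u *\<^sub>R p + v *\<^sub>R p') + (u *\<^sub>R q + v *\<^sub>R q')"
      unfolding pq by (simp add: algebra_simps)
    finally show "\<exists>p\<in>epi f. \<exists>q\<in>epi g. u *\<^sub>R z + v *\<^sub>R z' + (0, e) = p + q"
      using convexD[OF f(2) pq(1,4) uv] convexD[OF g(2) pq(2,5) uv] by blast
  qed
qed

text \<open>Only the \<open>f\<close>-summand of each decomposition is moved. With commutativity the
  same holds for \<open>g\<close>.\<close>

lemma recession_cone_epi_inf_convolution: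
  fixes f g :: "'a::real_vector \<Rightarrow> ereal"
  assumes f: "proper_fun f" and g: "proper_fun g"
  shows "recession_cone (epi f) \<subseteq> recession_cone (epi (inf_convolution f g))"
proof
  fix d assume d: "d \<in> recession_cone (epi f)"
  show "d \<in> recession_cone (epi (inf_convolution f g))"
    unfolding recession_cone_def epi_inf_convolution[OF f g]
  proof clarify
    fix z and t e :: real
    assume *: "\<forall>e>0. \<exists>p\<in>epi f. \<exists>q\<in>epi g. z + (0, e) = p + q" "0 \<le> t" "0 < e"
    then obtain p q where pq: "p \<in> epi f" "q \<in> epi g" "z + (0, e) = p + q" by blast
    have "z + t *\<^sub>R d + (0, e) = (z + (0, e)) + t *\<^sub>R d" by (simp add: algebra_simps)
    also have "\<dots> = (p + t *\<^sub>R d) + q" by (simp add: pq algebra_simps)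
    finally have eq: "z + t *\<^sub>R d + (0, e) = (p + t *\<^sub>R d) + q" .
    moreover have "p + t *\<^sub>R d \<in> epi f" using d pq *(2) by (simp add: recession_cone_def)
    ultimately show "\<exists>p\<in>epi f. \<exists>q\<in>epi g. z + t *\<^sub>R d + (0, e) = p + q" using pq(2) by blast
  qed
qed

lemma epi_nonempty:
  assumes "proper_fun \<phi>"
  obtains p where "p \<in> epi \<phi>"
proof -
  obtain x where "\<phi> x < \<infinity>" using assms by (auto simp: proper_fun_def dom_fun_def)
  then obtain M where "\<phi> x \<le> ereal M"
    using ereal_less_PInfty_bounded by blast
  then show thesis using that[of "(x, M)"] by (simp add: epi_def)
qed

text \<open>For a fixed \<open>q\<close> in \<open>epi g\<close>, the translate of
  \<open>epi f\<close> by \<open>q\<close> lies inside the epigraph of the convolution. With the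
  next lemma this gives the conjugate domain of the convolution.\<close>

lemma barrier_cone_epi_inf_convolution:
  fixes f g :: "'a::real_inner \<Rightarrow> ereal"
  assumes f: "proper_fun f" and g: "proper_fun g"
  shows "barrier_cone (epi (inf_convolution f g)) \<subseteq> barrier_cone (epi f)"
proof
  fix b assume "b \<in> barrier_cone (epi (inf_convolution f g))"
  then obtain M where M: "\<forall>z\<in>epi (inf_convolution f g). b \<bullet> z \<le> M"
    by (auto simp: barrier_cone_def)
  obtain q where q: "q \<in> epi g" using epi_nonempty[OF g] .
  have "p + q \<in> epi (inf_convolution f g)" if "p \<in> epi f" for p
    unfolding epi_inf_convolution[OF f g]
  proof (intro CollectI allI impI)
    fix e :: real assume "0 < e"
    then have "p + (0, e) \<in> epi f"
      using that by (auto simp: epi_def intro: order_trans)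
    then show "\<exists>p'\<in>epi f. \<exists>q'\<in>epi g. p + q + (0, e) = p' + q'"
      using q by (intro bexI[of _ "p + (0, e)"] bexI[of _ q]) (auto simp: algebra_simps)
  qed
  with M have "b \<bullet> (p + q) \<le> M" if "p \<in> epi f" for p using that by blast
  then have "\<forall>p\<in>epi f. b \<bullet> p \<le> M - b \<bullet> q" by (simp add: inner_add_right algebra_simps)
  then show "b \<in> barrier_cone (epi f)" by (auto simp: barrier_cone_def)
qed

lemma barrier_cone_epi_inf_convolutionI:
  fixes f g :: "'a::real_inner \<Rightarrow> ereal"
  assumes f: "proper_fun f" and g: "proper_fun g"
    and u: "(u, -1) \<in> barrier_cone (epi f)" "(u, -1) \<in> barrier_cone (epi g)"
  shows "(u, -1) \<in> barrier_cone (epi (inf_convolution f g))"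
proof -
  obtain M N where M: "\<forall>z\<in>epi f. (u, -1) \<bullet> z \<le> M" and N: "\<forall>z\<in>epi g. (u, -1) \<bullet> z \<le> N"
    using u by (auto simp: barrier_cone_def)
  \<comment> \<open>The extra 1 pays for the shift \<open>e = 1\<close> after which \<open>z\<close>
    splits exactly.\<close>
  have "(u, -1) \<bullet> z \<le> M + N + 1" if "z \<in> epi (inf_convolution f g)" for z
  proof -
    have "\<exists>p\<in>epi f. \<exists>q\<in>epi g. z + (0, 1) = p + q"
      using that unfolding epi_inf_convolution[OF f g] by (auto dest: spec[of _ 1])
    then obtain p q where pq: "p \<in> epi f" "q \<in> epi g" "z + (0, 1) = p + q" by blast
    have "(u, -1) \<bullet> (z + (0, 1)) \<le> M + N"
      using M N pq by (simp add: inner_add_right add_mono)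
    then show ?thesis by (simp add: inner_add_right)
  qed
  then show ?thesis unfolding barrier_cone_def by blast
qed


section \<open>Finite convex functions of linear growth\<close>

lemma recession_cone_epi_mono:
  assumes "(w, \<rho>) \<in> recession_cone (epi \<phi>)" "\<rho> \<le> \<rho>'"
  shows "(w, \<rho>') \<in> recession_cone (epi \<phi>)"
  unfolding recession_cone_def
proof (intro CollectI ballI allI impI)
  fix z and t :: real assume z: "z \<in> epi \<phi>" and t: "0 \<le> t"
  obtain x r where xr: "z = (x, r)" by (cases z)
  have "z + t *\<^sub>R (w, \<rho>) \<in> epi \<phi>" using assms(1) z t by (simp add: recession_cone_def)
  then have "\<phi> (x + t *\<^sub>R w) \<le> ereal (r + t * \<rho>)" by (simp add: xr epi_def)
  moreover have "r + t * \<rho> \<le> r + t * \<rho>'" using assms(2) t by (simp add: mult_left_mono)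
  ultimately have "\<phi> (x + t *\<^sub>R w) \<le> ereal (r + t * \<rho>')"
    by (meson ereal_less_eq(3) order_trans)
  then show "z + t *\<^sub>R (w, \<rho>') \<in> epi \<phi>" by (simp add: xr epi_def)
qed

lemma convex_cone_sum:
  assumes "convex_cone C" "\<And>i. i \<in> I \<Longrightarrow> f i \<in> C"
  shows "sum f I \<in> C"
  using assms(2)
  by (induction I rule: infinite_finite_induct)
    (auto intro: convex_cone_add[OF assms(1)] simp: convex_cone_contains_0[OF assms(1)])

text \<open>The conclusion encodes \<open>\<phi> (x + w) \<le> \<phi> x + L * norm w\<close>. Slopes
  along the signed basis vectors are added up coordinatewise in the recession cone.\<close>

lemma recession_cone_epi_linear_growth:
  fixes \<phi> :: "'a::euclidean_space \<Rightarrow> ereal"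
  assumes "\<And>w. \<exists>\<rho>. (w, \<rho>) \<in> recession_cone (epi \<phi>)"
  obtains L where "\<And>w. (w, L * norm w) \<in> recession_cone (epi \<phi>)"
proof -
  let ?K = "recession_cone (epi \<phi>)"
  obtain \<rho> where \<rho>: "\<And>w. (w, \<rho> w) \<in> ?K" using assms by metis
  \<comment> \<open>Dominates the slopes in both directions of \<open>i\<close>, and is nonnegative
    so that the coordinate of \<open>w\<close> may be enlarged to \<open>norm w\<close>.\<close>
  define c where "c i = \<bar>\<rho> i\<bar> + \<bar>\<rho> (- i)\<bar>" for i
  have c: "(i, c i) \<in> ?K" "(- i, c i) \<in> ?K" for i
    by (rule recession_cone_epi_mono[OF \<rho>], simp add: c_def)+
  have *: "((w \<bullet> i) *\<^sub>R i, norm w * c i) \<in> ?K" if i: "i \<in> Basis" for w i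
  proof -
    have "((w \<bullet> i) *\<^sub>R i, \<bar>w \<bullet> i\<bar> * c i) \<in> ?K"
    proof (cases "w \<bullet> i \<ge> 0")
      case True
      then show ?thesis
        using convex_cone_scaleR[OF convex_cone_recession_cone True c(1)[of i]] by simp
    next
      case False
      then have "- (w \<bullet> i) \<ge> 0" by simp
      from convex_cone_scaleR[OF convex_cone_recession_cone this c(2)[of i]] False
      show ?thesis by simp
    qed
    then show ?thesis
      by (rule recession_cone_epi_mono)
        (intro mult_right_mono Basis_le_norm[OF i], simp add: c_def)
  qed
  have "(w, (\<Sum>i\<in>Basis. c i) * norm w) \<in> ?K" for w
  proof -
    have "(\<Sum>i\<in>Basis. ((w \<bullet> i) *\<^sub>R i, norm w * c i)) \<in> ?K"
      by (rule convex_cone_sum[OF convex_cone_recession_cone *])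
    also have "(\<Sum>i\<in>Basis. ((w \<bullet> i) *\<^sub>R i, norm w * c i)) = (w, (\<Sum>i\<in>Basis. c i) * norm w)"
      by (simp add: prod_eq_iff fst_sum snd_sum euclidean_representation
          sum_distrib_left[symmetric] mult.commute)
    finally show ?thesis .
  qed
  then show thesis using that by blast
qed

text \<open>A tangent direction \<open>w\<close> is tested along the ray \<open>x\<^sub>k = k w\<close>, on which the slopes of
  \<open>\<phi>\<close> increase to a limit that is at least \<open>u \<bullet> w\<close>; the linear growth makes \<open>\<phi>\<close> Lipschitz, so
  that replacing \<open>w\<^sub>k\<close> by \<open>w\<close> is harmless.\<close>

lemma barrier_cone_imp_subdiff_at_infinity:
  fixes \<phi> :: "'a::euclidean_space \<Rightarrow> ereal"
  assumes fin: "finite_valued \<phi>" and conv: "convex (epi \<phi>)"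
    and growth: "\<And>w. \<exists>\<rho>. (w, \<rho>) \<in> recession_cone (epi \<phi>)"
    and u: "(u, -1) \<in> barrier_cone (epi \<phi>)"
  shows "u \<in> subdiff_at_infinity \<phi>"
proof -
  define F where "F x = real_of_ereal (\<phi> x)" for x
  have F: "\<phi> x = ereal (F x)" for x
    using fin by (simp add: F_def finite_valued_def ereal_real')
  obtain L where L: "\<And>w. (w, L * norm w) \<in> recession_cone (epi \<phi>)"
    using recession_cone_epi_linear_growth[OF growth] by blast
  have lip: "F (x + d) \<le> F x + L * norm d" for x d
  proof -
    have "(x, F x) \<in> epi \<phi>" by (simp add: epi_def F)
    then have "(x, F x) + 1 *\<^sub>R (d, L * norm d) \<in> epi \<phi>"
      using L[of d] zero_le_one unfolding recession_cone_def by blast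
    then show ?thesis by (simp add: epi_def F)
  qed
  obtain M where "\<forall>z\<in>epi \<phi>. (u, -1) \<bullet> z \<le> M"
    using u by (auto simp: barrier_cone_def)
  then have M: "u \<bullet> x - F x \<le> M" for x
    by (auto simp: epi_def F dest: bspec[of _ _ "(x, F x)"])
  \<comment> \<open>Used for \<open>w = 0\<close>, where the lower bound on the increment reduces to
    this sign.\<close>
  have M0: "0 \<le> M + F 0" using M[of 0] by simp
  \<comment> \<open>By convexity the slope beyond \<open>n *\<^sub>R w\<close> is at least the slope
    from 0 to that point, which \<open>M\<close> bounds from below; denominators are
    cleared.\<close>
  have slope: "n * (F (n *\<^sub>R w + t *\<^sub>R w) - F (n *\<^sub>R w)) \<ge> t * (n * (u \<bullet> w) - (M + F 0))"
    if "0 < n" "0 < t" for n t w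
  proof -
    let ?y = "n *\<^sub>R w + t *\<^sub>R w"
    have "(t / (n + t)) *\<^sub>R (0, F 0) + (n / (n + t)) *\<^sub>R (?y, F ?y) \<in> epi \<phi>"
      using that by (intro convexD[OF conv]) (auto simp: epi_def F add_divide_distrib[symmetric])
    moreover have "(n / (n + t)) *\<^sub>R ?y = n *\<^sub>R w"
      using that by (simp add: scaleR_add_left[symmetric])
    ultimately have "F (n *\<^sub>R w) \<le> (t / (n + t)) * F 0 + (n / (n + t)) * F ?y"
      by (simp add: epi_def F)
    also have "\<dots> = (t * F 0 + n * F ?y) / (n + t)" by (simp add: add_divide_distrib)
    finally have "(n + t) * F (n *\<^sub>R w) \<le> t * F 0 + n * F ?y"
      using that by (simp add: field_simps)
    moreover have "t * (n * (u \<bullet> w) - M) \<le> t * F (n *\<^sub>R w)"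
      using M[of "n *\<^sub>R w"] that by (intro mult_left_mono) auto
    ultimately show ?thesis by (simp add: algebra_simps)
  qed
  have "u \<bullet> w \<le> \<rho>" if T: "(w, \<rho>) \<in> tangent_at_infinity (epi \<phi>)" for w \<rho>
  proof -
    obtain b :: 'a where b: "b \<in> Basis" using nonempty_Basis by blast
    \<comment> \<open>For \<open>w = 0\<close> the ray would stay at the origin, so a basis vector
      replaces it.\<close>
    define v where "v = (if w = 0 then b else w)"
    have v0: "v \<noteq> 0" using b by (auto simp: v_def)
    define z where "z k = (real (Suc k) *\<^sub>R v, F (real (Suc k) *\<^sub>R v))" for k
    \<comment> \<open>The step is the reciprocal of the ray parameter: multiplying increments by
      that parameter yields difference quotients, with an error \<open>(M + F 0) * t k\<close> that
      vanishes.\<close>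
    define t where "t k = inverse (real (Suc k))" for k
    have "filterlim (\<lambda>k. norm (fst (z k))) at_top sequentially"
    proof -
      have "filterlim (\<lambda>k. norm v * real (Suc k)) at_top sequentially"
        using v0 by (intro filterlim_tendsto_pos_mult_at_top[OF tendsto_const]
            filterlim_compose[OF filterlim_real_sequentially filterlim_Suc]) auto
      then show ?thesis by (simp add: z_def mult.commute)
    qed
    moreover have "\<forall>k. z k \<in> epi \<phi>" by (simp add: z_def epi_def F)
    moreover have tpos: "\<forall>k. t k > 0" by (simp add: t_def)
    moreover have tlim: "t \<longlonglongrightarrow> 0" unfolding t_def by (rule LIMSEQ_inverse_real_of_nat)
    ultimately obtain s where s: "s \<longlonglongrightarrow> (w, \<rho>)" "\<And>k. z k + t k *\<^sub>R s k \<in> epi \<phi>"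
      using T unfolding tangent_at_infinity_def by blast
    have lim: "(\<lambda>k. fst (s k)) \<longlonglongrightarrow> w" "(\<lambda>k. snd (s k)) \<longlonglongrightarrow> \<rho>"
      using tendsto_fst[OF s(1)] tendsto_snd[OF s(1)] by simp_all
    have le: "u \<bullet> w - (M + F 0) * t k \<le> snd (s k) + L * norm (w - fst (s k))" for k
    proof -
      let ?n = "real (Suc k)"
      let ?x = "?n *\<^sub>R v"
      have n: "?n * t k = 1" by (simp add: t_def)
      have "F (?x + t k *\<^sub>R w) \<le> F (?x + t k *\<^sub>R fst (s k)) + L * norm (t k *\<^sub>R (w - fst (s k)))"
        using lip[of "?x + t k *\<^sub>R fst (s k)" "t k *\<^sub>R (w - fst (s k))"]
        by (simp add: algebra_simps)
      also have "norm (t k *\<^sub>R (w - fst (s k))) = t k * norm (w - fst (s k))"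
        using tpos by (simp add: less_imp_le)
      also have "F (?x + t k *\<^sub>R fst (s k)) \<le> F ?x + t k * snd (s k)"
        using s(2)[of k] by (cases "s k") (auto simp: z_def epi_def F)
      finally have up: "F (?x + t k *\<^sub>R w) - F ?x
          \<le> t k * (snd (s k) + L * norm (w - fst (s k)))" by (simp add: algebra_simps)
      have "t k * (?n * (u \<bullet> w) - (M + F 0)) \<le> ?n * (F (?x + t k *\<^sub>R w) - F ?x)"
      proof (cases "w = 0")
        case True
        then show ?thesis using M0 tpos[rule_format, of k]
          by (simp add: mult_nonneg_nonpos del: of_nat_Suc)
      next
        case False
        then show ?thesis using slope[of ?n "t k" w] tpos by (simp add: v_def del: of_nat_Suc)
      qed
      also have "\<dots> \<le> ?n * (t k * (snd (s k) + L * norm (w - fst (s k))))"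
        by (rule mult_left_mono[OF up]) simp
      also have "\<dots> = snd (s k) + L * norm (w - fst (s k))"
        using n by (simp only: mult.assoc[symmetric] mult_1)
      also have "t k * (?n * (u \<bullet> w) - (M + F 0)) = (?n * t k) * (u \<bullet> w) - (M + F 0) * t k"
        by (simp only: algebra_simps)
      finally show ?thesis unfolding n by simp
    qed
    have "(\<lambda>k. u \<bullet> w - (M + F 0) * t k) \<longlonglongrightarrow> u \<bullet> w - (M + F 0) * 0"
      by (intro tendsto_intros tlim)
    moreover have "(\<lambda>k. snd (s k) + L * norm (w - fst (s k))) \<longlonglongrightarrow> \<rho> + L * norm (w - w)"
      by (intro tendsto_intros lim)
    ultimately have "u \<bullet> w - (M + F 0) * 0 \<le> \<rho> + L * norm (w - w)"
      using le by (intro LIMSEQ_le) auto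
    then show ?thesis by simp
  qed
  then show ?thesis by (auto simp: subdiff_at_infinity_def normal_at_infinity_def)
qed

section \<open>Sublinear and polyhedral functions\<close>

lemma recession_cone_epi_sublinear:
  assumes f: "sublinear_fun f" "finite_valued f"
  shows "(w, real_of_ereal (f w)) \<in> recession_cone (epi f)"
  unfolding recession_cone_def
proof (intro CollectI ballI allI impI)
  fix z and t :: real assume z: "z \<in> epi f" and t: "0 \<le> t"
  obtain x r where xr: "z = (x, r)" by (cases z)
  have fw: "f w = ereal (real_of_ereal (f w))"
    using f(2) by (simp add: finite_valued_def ereal_real')
  show "z + t *\<^sub>R (w, real_of_ereal (f w)) \<in> epi f"
  \<comment> \<open>Homogeneity is available only for positive factors.\<close>
  proof (cases "t = 0")
    case True
    then show ?thesis using z by (simp add: xr)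
  next
    case False
    have "f (x + t *\<^sub>R w) \<le> f x + f (t *\<^sub>R w)" using f(1) by (simp add: sublinear_fun_def)
    also have "f (t *\<^sub>R w) = ereal t * f w" using f(1) False t by (simp add: sublinear_fun_def)
    also have "\<dots> = ereal (t * real_of_ereal (f w))" by (subst fw) simp
    also have "f x \<le> ereal r" using z by (simp add: xr epi_def)
    finally show ?thesis by (simp add: xr epi_def add_mono)
  qed
qed

text \<open>Graph points are themselves recession directions, so polarity reads
  \<open>u \<bullet> x \<le> f x\<close> and 0 is a bound, without passing to a closure.\<close>

lemma sublinear_polar_recession_cone_subset_barrier_cone:
  assumes f: "sublinear_fun f" "finite_valued f"
    and u: "\<And>d. d \<in> recession_cone (epi f) \<Longrightarrow> (u, -1) \<bullet> d \<le> 0"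
  shows "(u, -1) \<in> barrier_cone (epi f)"
proof -
  have "u \<bullet> x - r \<le> 0" if "f x \<le> ereal r" for x r
  proof -
    have "f x = ereal (real_of_ereal (f x))"
      using f(2) by (simp add: finite_valued_def ereal_real')
    then have "real_of_ereal (f x) \<le> r" using that by (metis ereal_less_eq(3))
    then show ?thesis using u[OF recession_cone_epi_sublinear[OF f, of x]] by simp
  qed
  then show ?thesis by (auto simp: barrier_cone_def epi_def intro!: exI[of _ 0])
qed

text \<open>If the recession directions of the two epigraphs did not project onto the whole space,
  they would lie in a half-space with some normal \<open>a\<close>; by polyhedrality \<open>a\<close> would then be bounded
  above on both domains, hence on their sum.\<close>

lemma polyhedral_recession_cones_span:
  fixes f g :: "'a::euclidean_space \<Rightarrow> ereal"
  assumes f: "proper_fun f" "polyhedron (epi f)" and g: "proper_fun g" "polyhedron (epi g)"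
    and UN: "{x + y |x y. x \<in> dom_fun f \<and> y \<in> dom_fun g} = UNIV"
  shows "\<exists>d\<in>recession_cone (epi f). \<exists>e\<in>recession_cone (epi g). w = fst d + fst e"
proof (rule ccontr)
  let ?P = "fst ` (\<Union>d\<in>recession_cone (epi f). \<Union>e\<in>recession_cone (epi g). {d + e})"
  assume "\<not> ?thesis"
  then have w: "w \<notin> ?P" by force
  have P: "convex_cone ?P"
    using convex_cone_sums[OF convex_cone_recession_cone convex_cone_recession_cone]
      bounded_linear.linear[OF bounded_linear_fst]
    by (intro convex_cone_linear_image conjI)
  \<comment> \<open>Weak separation from the single point \<open>w\<close> suffices: only
    \<open>a \<noteq> 0\<close> and the bound on the projected cone are used below.\<close>
  obtain a b where a: "a \<noteq> 0" "\<forall>x\<in>?P. a \<bullet> x \<le> b"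
    using separating_hyperplane_sets[of ?P "{w}"] P w
    by (auto simp: convex_cone_def)
  have aP: "a \<bullet> x \<le> 0" if "x \<in> ?P" for x
    by (rule convex_cone_bounded_above_imp_nonpos[OF P _ that]) (use a in blast)
  have "(a, 0) \<bullet> d \<le> 0" if "d \<in> recession_cone (epi f)" for d
  proof -
    have "fst d \<in> ?P"
      using that convex_cone_contains_0[OF convex_cone_recession_cone[of "epi g"]] by force
    then show ?thesis using aP by (simp add: inner_prod_def)
  qed
  then have "(a, 0) \<in> barrier_cone (epi f)"
    by (rule polar_recession_cone_subset_barrier_cone_polyhedron[OF f(2)])
  then obtain M where M: "\<forall>z\<in>epi f. (a, 0) \<bullet> z \<le> M" by (auto simp: barrier_cone_def)
  have "(a, 0) \<bullet> d \<le> 0" if "d \<in> recession_cone (epi g)" for d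
  proof -
    have "fst d \<in> ?P"
      using that convex_cone_contains_0[OF convex_cone_recession_cone[of "epi f"]] by force
    then show ?thesis using aP by (simp add: inner_prod_def)
  qed
  then have "(a, 0) \<in> barrier_cone (epi g)"
    by (rule polar_recession_cone_subset_barrier_cone_polyhedron[OF g(2)])
  then obtain N where N: "\<forall>z\<in>epi g. (a, 0) \<bullet> z \<le> N" by (auto simp: barrier_cone_def)
  have dom: "\<exists>r. (x, r) \<in> epi \<phi>" if "x \<in> dom_fun \<phi>" for x and \<phi> :: "'a \<Rightarrow> ereal"
    using that ereal_less_PInfty_bounded by (auto simp: dom_fun_def epi_def)
  have "a \<bullet> x \<le> M + N" for x
  proof -
    obtain y z where "x = y + z" "y \<in> dom_fun f" "z \<in> dom_fun g" using UN by blast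
    moreover obtain r s where "(y, r) \<in> epi f" "(z, s) \<in> epi g" using dom calculation by meson
    ultimately show ?thesis using M N by (fastforce simp: inner_add_right)
  qed
  \<comment> \<open>The whole space is a cone, so a functional bounded above on it is nonpositive,
    in particular at \<open>a\<close>.\<close>
  then have "a \<bullet> a \<le> 0"
    by (intro convex_cone_bounded_above_imp_nonpos[of UNIV]) (auto simp: convex_cone_iff)
  then show False using a(1) inner_gt_zero_iff[of a] by linarith
qed

section \<open>Subdifferential at infinity of an infimal convolution\<close>

theorem proposition4p23:
  fixes f g h :: "real ^ 'n \<Rightarrow> ereal"
  assumes "proper_fun f" and "lsc f" and "convex_fun f"
    and "proper_fun g" and "lsc g" and "convex_fun g"
    and "h = inf_convolution f g"
    and "proper_fun h" and "lsc h" and "\<not> bounded (dom_fun h)"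
  shows
    "subdiff_at_infinity h \<subseteq>
       closure (dom_fun (fenchel_conjugate f) \<inter> dom_fun (fenchel_conjugate g)) \<and>
     (sublinear_fun f \<and> finite_valued f \<and> sublinear_fun g \<and> finite_valued g \<longrightarrow>
       subdiff_at_infinity h = subdiff_at_infinity f \<inter> subdiff_at_infinity g) \<and>
     (polyhedral_fun f \<and> polyhedral_fun g \<longrightarrow>
       subdiff_at_infinity h \<subseteq>
         dom_fun (fenchel_conjugate f) \<inter> dom_fun (fenchel_conjugate g) \<and>
       ({x + y |x y. x \<in> dom_fun f \<and> y \<in> dom_fun g} = UNIV \<longrightarrow>
         subdiff_at_infinity h =
           dom_fun (fenchel_conjugate f) \<inter> dom_fun (fenchel_conjugate g)))"
proof -
  have f: "proper_fun f" "convex (epi f)" and g: "proper_fun g" "convex (epi g)"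
    using assms by (auto simp: convex_fun_def)
  have h': "h = inf_convolution g f" using assms(7) inf_convolution_commute by metis
  have conv: "convex (epi h)"
    using convex_epi_inf_convolution[OF f g] assms(7) by simp
  have recf: "recession_cone (epi f) \<subseteq> recession_cone (epi h)"
    using recession_cone_epi_inf_convolution[OF f(1) g(1)] assms(7) by simp
  have recg: "recession_cone (epi g) \<subseteq> recession_cone (epi h)"
    using recession_cone_epi_inf_convolution[OF g(1) f(1)] h' by simp
  have domI: "dom_fun (fenchel_conjugate f) \<inter> dom_fun (fenchel_conjugate g) =
      {u. (u, -1) \<in> barrier_cone (epi f) \<and> (u, -1) \<in> barrier_cone (epi g)}"
    using dom_fenchel_conjugate_iff assms(1,4) by blast
  have dom: "dom_fun (fenchel_conjugate f) \<inter> dom_fun (fenchel_conjugate g) =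
      {u. (u, -1) \<in> barrier_cone (epi h)}"
    unfolding domI
    using barrier_cone_epi_inf_convolution[OF f(1) assms(4)]
      barrier_cone_epi_inf_convolution[OF g(1) assms(1)]
      barrier_cone_epi_inf_convolutionI[OF f(1) g(1)] assms(7) h' by auto
  have i: "subdiff_at_infinity h \<subseteq>
      closure (dom_fun (fenchel_conjugate f) \<inter> dom_fun (fenchel_conjugate g))"
    unfolding dom
    using closure_barrier_cone_normalized polar_recession_cone_subset_closure_barrier_cone[OF conv
        closed_epi[OF assms(9)]] subdiff_at_infinityD by blast
  have ii: "subdiff_at_infinity h = subdiff_at_infinity f \<inter> subdiff_at_infinity g"
    if sf: "sublinear_fun f" "finite_valued f" and sg: "sublinear_fun g" "finite_valued g"
  proof -
    have sub: "subdiff_at_infinity \<phi> = {u. (u, -1) \<in> barrier_cone (epi \<phi>)}"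
      if "sublinear_fun \<phi>" "finite_valued \<phi>" "convex (epi \<phi>)" for \<phi> :: "real ^ 'n \<Rightarrow> ereal"
      using barrier_cone_imp_subdiff_at_infinity[OF that(2,3)]
        recession_cone_epi_sublinear[OF that(1,2)]
        sublinear_polar_recession_cone_subset_barrier_cone[OF that(1,2)] subdiff_at_infinityD
      by blast
    have "finite_valued h"
      unfolding finite_valued_def
    proof
      fix x
      have "h x \<le> f (x - 0) + g 0"
        unfolding assms(7) inf_convolution_def by (rule INF_lower) simp
      also have "\<dots> < \<infinity>" using sf(2)[unfolded finite_valued_def, rule_format, of x]
          sg(2)[unfolded finite_valued_def, rule_format, of 0]
        by (cases "f x"; cases "g 0") auto
      finally show "\<bar>h x\<bar> \<noteq> \<infinity>" using assms(8) by (auto simp: proper_fun_def)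
    qed
    \<comment> \<open>The growth condition for \<open>h\<close> is inherited from \<open>f\<close>,
      whose recession directions are also those of \<open>epi h\<close>.\<close>
    then have "{u. (u, -1) \<in> barrier_cone (epi h)} \<subseteq> subdiff_at_infinity h"
      using barrier_cone_imp_subdiff_at_infinity[OF _ conv] recf
        recession_cone_epi_sublinear[OF sf] by blast
    \<comment> \<open>The larger recession cone of \<open>epi h\<close> has the smaller polar, so
      sublinearity of \<open>f\<close> alone gives the bound.\<close>
    moreover have "subdiff_at_infinity h \<subseteq> {u. (u, -1) \<in> barrier_cone (epi f)}"
      using sublinear_polar_recession_cone_subset_barrier_cone[OF sf] recf subdiff_at_infinityD
      by blast
    moreover have "subdiff_at_infinity h \<subseteq> {u. (u, -1) \<in> barrier_cone (epi g)}"
      using sublinear_polar_recession_cone_subset_barrier_cone[OF sg] recg subdiff_at_infinityD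
      by blast
    ultimately show ?thesis
      using sub[OF sf f(2)] sub[OF sg g(2)] dom domI by blast
  qed
  have iii: "subdiff_at_infinity h \<subseteq>
         dom_fun (fenchel_conjugate f) \<inter> dom_fun (fenchel_conjugate g)"
    if "polyhedral_fun f" "polyhedral_fun g"
  proof
    fix u assume u: "u \<in> subdiff_at_infinity h"
    \<comment> \<open>Farkas' lemma is applied to the two summands separately, after shrinking the
      recession cone of \<open>epi h\<close> to theirs.\<close>
    have "(u, -1) \<in> barrier_cone (epi f)"
      using that(1) unfolding polyhedral_fun_def
      by (rule polar_recession_cone_subset_barrier_cone_polyhedron)
        (use subdiff_at_infinityD[OF u] recf in blast)
    moreover have "(u, -1) \<in> barrier_cone (epi g)"
      using that(2) unfolding polyhedral_fun_def
      by (rule polar_recession_cone_subset_barrier_cone_polyhedron)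
        (use subdiff_at_infinityD[OF u] recg in blast)
    ultimately show "u \<in> dom_fun (fenchel_conjugate f) \<inter> dom_fun (fenchel_conjugate g)"
      by (simp add: domI)
  qed
  have iii': "dom_fun (fenchel_conjugate f) \<inter> dom_fun (fenchel_conjugate g)
      \<subseteq> subdiff_at_infinity h"
    if pf: "polyhedral_fun f" and pg: "polyhedral_fun g"
      and UN: "{x + y |x y. x \<in> dom_fun f \<and> y \<in> dom_fun g} = UNIV"
  proof -
    have "finite_valued h"
      unfolding finite_valued_def
    proof
      fix x
      obtain v y where vy: "x = v + y" "v \<in> dom_fun f" "y \<in> dom_fun g" using UN by blast
      have "h x \<le> f (x - y) + g y"
        unfolding assms(7) inf_convolution_def by (rule INF_lower) simp
      also have "\<dots> < \<infinity>" using vy by (simp add: dom_fun_def)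
      finally show "\<bar>h x\<bar> \<noteq> \<infinity>" using assms(8) by (auto simp: proper_fun_def)
    qed
    \<comment> \<open>Each \<open>w\<close> splits into projected recession directions of the two
      epigraphs; both recede in \<open>epi h\<close>, hence so does their sum.\<close>
    moreover have "\<exists>\<rho>. (w, \<rho>) \<in> recession_cone (epi h)" for w
    proof -
      obtain d e where "d \<in> recession_cone (epi f)" "e \<in> recession_cone (epi g)"
        "w = fst d + fst e"
        using polyhedral_recession_cones_span[OF assms(1) _ assms(4) _ UN] pf pg
        unfolding polyhedral_fun_def by blast
      then have "(w, snd (d + e)) \<in> recession_cone (epi h)"
        using convex_cone_add[OF convex_cone_recession_cone, of d "epi h" e] recf recg
        by (metis fst_add prod.collapse subsetD)
      then show ?thesis by blast
    qed
    ultimately show ?thesis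
      unfolding dom using barrier_cone_imp_subdiff_at_infinity[OF _ conv] by blast
  qed
  show ?thesis using i ii iii iii' by blast
qed

end
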